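(* Let $F\colon \mathcal{C}_1\to \mathcal{C}_2$ be a functor. Let $L_1$ be a localization on $\mathcal{C}_1$ with unit $l_1\colon \mathrm{Id}\to L_1$ and let $L_2$ be a localization on $\mathcal{C}_2$ with unit $l_2\colon \mathrm{Id}\to L_2$. Then the following hold: (i) $F$ preserves equivalences if and only if there is a natural transformation $\alpha\colon FL_1\longrightarrow L_2F$ such that $\alpha\circ Fl_1=l_2F$. If this holds, then $\alpha$ is unique and $\alpha_X$ is an $L_2$-equivalence for all $X$. Moreover, $\alpha$ is an isomorphism if and only if $F$ preserves local objects. (ii) $F$ preserves local objects if and only if there is a natural transformation $\beta\colon L_2F\longrightarrow FL_1$ such that $\beta\circ l_2F=Fl_1$. If this holds, then $\beta$ is unique, and it is an isomorphism if and only if $F$ preserves equivalences.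
   Context: A localization on a category $\mathcal{C}$ is a functor $L=JK\colon\mathcal{C}\to\mathcal{C}$ where $J\colon\mathcal{S}\hookrightarrow\mathcal{C}$ is the inclusion of a full reflective subcategory and $K$ is left adjoint to $J$; its unit $l\colon\mathrm{Id}\to L$ is the unit of this adjunction, and $(L,l)$ is an idempotent monad. An object $X$ is $L$-local if it is isomorphic to an object of $\mathcal{S}$ (equivalently, $l_X$ is an isomorphism). A morphism $g$ is an $L$-equivalence if $Lg$ is an isomorphism. Given localizations $L_1$ on $\mathcal{C}_1$ and $L_2$ on $\mathcal{C}_2$, a functor $F\colon\mathcal{C}_1\to\mathcal{C}_2$ preserves local objects if $FX$ is $L_2$-local for every $L_1$-local object $X$, and $F$ preserves equivalences if $Ff$ is an $L_2$-equivalence whenever $f$ is an $L_1$-equivalence. *)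

theory Defs
  imports Main
begin

text \<open>
  Objects and arrows are carved out of types by the sets \<open>Obj\<close> and \<open>Arr\<close>; all operations
  are meaningful on these sets only, so every equation between them is relativised.
  \<open>Comp C g f\<close> is written in the usual order (first \<open>f\<close>, then \<open>g\<close>).
\<close>

record ('o, 'm) cat =
  Obj :: "'o set"
  Arr :: "'m set"
  Dom :: "'m \<Rightarrow> 'o"
  Cod :: "'m \<Rightarrow> 'o"
  Ident :: "'o \<Rightarrow> 'm"
  Comp :: "'m \<Rightarrow> 'm \<Rightarrow> 'm"

definition hom :: "('o, 'm) cat \<Rightarrow> 'o \<Rightarrow> 'o \<Rightarrow> 'm set" where
  "hom C a b = {f \<in> Arr C. Dom C f = a \<and> Cod C f = b}"

locale category =
  fixes C :: "('o, 'm) cat"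
  assumes dom_obj: "f \<in> Arr C \<Longrightarrow> Dom C f \<in> Obj C"
    and cod_obj: "f \<in> Arr C \<Longrightarrow> Cod C f \<in> Obj C"
    and ident_hom: "a \<in> Obj C \<Longrightarrow> Ident C a \<in> hom C a a"
    and comp_hom: "f \<in> hom C a b \<Longrightarrow> g \<in> hom C b c \<Longrightarrow> Comp C g f \<in> hom C a c"
    and comp_ident_right: "f \<in> hom C a b \<Longrightarrow> Comp C f (Ident C a) = f"
    and comp_ident_left: "f \<in> hom C a b \<Longrightarrow> Comp C (Ident C b) f = f"
    and comp_assoc: "f \<in> hom C a b \<Longrightarrow> g \<in> hom C b c \<Longrightarrow> h \<in> hom C c d \<Longrightarrow>
      Comp C (Comp C h g) f = Comp C h (Comp C g f)"

definition iso_between :: "('o, 'm) cat \<Rightarrow> 'o \<Rightarrow> 'o \<Rightarrow> 'm \<Rightarrow> bool" where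
  "iso_between C a b f \<longleftrightarrow> f \<in> hom C a b \<and>
     (\<exists>g \<in> hom C b a. Comp C g f = Ident C a \<and> Comp C f g = Ident C b)"

definition is_iso :: "('o, 'm) cat \<Rightarrow> 'm \<Rightarrow> bool" where
  "is_iso C f \<longleftrightarrow> iso_between C (Dom C f) (Cod C f) f"

definition isomorphic :: "('o, 'm) cat \<Rightarrow> 'o \<Rightarrow> 'o \<Rightarrow> bool" where
  "isomorphic C a b \<longleftrightarrow> a \<in> Obj C \<and> b \<in> Obj C \<and> (\<exists>f. iso_between C a b f)"

record ('o1, 'm1, 'o2, 'm2) cat_maps =
  OMap :: "'o1 \<Rightarrow> 'o2"
  AMap :: "'m1 \<Rightarrow> 'm2"

locale cat_functor = C: category C + D: category D
  for C :: "('o1, 'm1) cat" and D :: "('o2, 'm2) cat" +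
  fixes F :: "('o1, 'm1, 'o2, 'm2) cat_maps"
  assumes omap_obj: "a \<in> Obj C \<Longrightarrow> OMap F a \<in> Obj D"
    and amap_hom: "f \<in> hom C a b \<Longrightarrow> AMap F f \<in> hom D (OMap F a) (OMap F b)"
    and amap_ident: "a \<in> Obj C \<Longrightarrow> AMap F (Ident C a) = Ident D (OMap F a)"
    and amap_comp: "f \<in> hom C a b \<Longrightarrow> g \<in> hom C b c \<Longrightarrow>
      AMap F (Comp C g f) = Comp D (AMap F g) (AMap F f)"

text \<open>These maps serve both as the identity functor and as the inclusion of a subcategory.\<close>

definition id_maps :: "('o, 'm, 'o, 'm) cat_maps" where
  "id_maps = \<lparr>OMap = (\<lambda>a. a), AMap = (\<lambda>f. f)\<rparr>"

definition comp_maps ::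
  "('o2, 'm2, 'o3, 'm3) cat_maps \<Rightarrow> ('o1, 'm1, 'o2, 'm2) cat_maps \<Rightarrow>
   ('o1, 'm1, 'o3, 'm3) cat_maps"  (infixr "\<circ>\<^sub>F" 75) where
  "G \<circ>\<^sub>F F = \<lparr>OMap = (\<lambda>a. OMap G (OMap F a)), AMap = (\<lambda>f. AMap G (AMap F f))\<rparr>"

locale nat_transf = F: cat_functor C D F + G: cat_functor C D G
  for C :: "('o1, 'm1) cat" and D :: "('o2, 'm2) cat"
    and F :: "('o1, 'm1, 'o2, 'm2) cat_maps" and G :: "('o1, 'm1, 'o2, 'm2) cat_maps" +
  fixes \<tau> :: "'o1 \<Rightarrow> 'm2"
  assumes component_hom: "a \<in> Obj C \<Longrightarrow> \<tau> a \<in> hom D (OMap F a) (OMap G a)"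
    and naturality: "f \<in> hom C a b \<Longrightarrow> Comp D (\<tau> b) (AMap F f) = Comp D (AMap G f) (\<tau> a)"

text \<open>
  Components outside \<open>Obj C\<close> are irrelevant, so \<open>eq_transf\<close> is the notion of equality of
  natural transformations between functors with source \<open>C\<close>.
\<close>

definition eq_transf :: "('o1, 'm1) cat \<Rightarrow> ('o1 \<Rightarrow> 'm2) \<Rightarrow> ('o1 \<Rightarrow> 'm2) \<Rightarrow> bool" where
  "eq_transf C \<sigma> \<tau> \<longleftrightarrow> (\<forall>a \<in> Obj C. \<sigma> a = \<tau> a)"

definition id_transf ::
  "('o2, 'm2) cat \<Rightarrow> ('o1, 'm1, 'o2, 'm2) cat_maps \<Rightarrow> ('o1 \<Rightarrow> 'm2)" where
  "id_transf D F = (\<lambda>a. Ident D (OMap F a))"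

definition comp_transf ::
  "('o2, 'm2) cat \<Rightarrow> ('o1 \<Rightarrow> 'm2) \<Rightarrow> ('o1 \<Rightarrow> 'm2) \<Rightarrow> ('o1 \<Rightarrow> 'm2)" where
  "comp_transf D \<sigma> \<tau> = (\<lambda>a. Comp D (\<sigma> a) (\<tau> a))"

text \<open>The whiskerings \<open>F\<tau>\<close> and \<open>\<tau>F\<close>.\<close>

definition functor_transf ::
  "('o2, 'm2, 'o3, 'm3) cat_maps \<Rightarrow> ('o1 \<Rightarrow> 'm2) \<Rightarrow> ('o1 \<Rightarrow> 'm3)" where
  "functor_transf F \<tau> = (\<lambda>a. AMap F (\<tau> a))"

definition transf_functor ::
  "('o2 \<Rightarrow> 'm3) \<Rightarrow> ('o1, 'm1, 'o2, 'm2) cat_maps \<Rightarrow> ('o1 \<Rightarrow> 'm3)" where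
  "transf_functor \<tau> F = (\<lambda>a. \<tau> (OMap F a))"

definition nat_iso ::
  "('o1, 'm1) cat \<Rightarrow> ('o2, 'm2) cat \<Rightarrow> ('o1, 'm1, 'o2, 'm2) cat_maps \<Rightarrow>
   ('o1, 'm1, 'o2, 'm2) cat_maps \<Rightarrow> ('o1 \<Rightarrow> 'm2) \<Rightarrow> bool" where
  "nat_iso C D F G \<tau> \<longleftrightarrow> nat_transf C D F G \<tau> \<and>
     (\<exists>\<sigma>. nat_transf C D G F \<sigma> \<and>
          eq_transf C (comp_transf D \<sigma> \<tau>) (id_transf D F) \<and>
          eq_transf C (comp_transf D \<tau> \<sigma>) (id_transf D G))"

text \<open>\<open>K : C \<rightarrow> S\<close> is left adjoint to \<open>J : S \<rightarrow> C\<close>, with unit \<open>\<eta>\<close> and counit \<open>\<epsilon>\<close>.\<close>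

locale adjunction =
  K: cat_functor C S K + J: cat_functor S C J +
  unit: nat_transf C C id_maps "J \<circ>\<^sub>F K" \<eta> + counit: nat_transf S S "K \<circ>\<^sub>F J" id_maps \<epsilon>
  for C :: "('o1, 'm1) cat" and S :: "('o2, 'm2) cat"
    and K :: "('o1, 'm1, 'o2, 'm2) cat_maps" and J :: "('o2, 'm2, 'o1, 'm1) cat_maps"
    and \<eta> :: "'o1 \<Rightarrow> 'm1" and \<epsilon> :: "'o2 \<Rightarrow> 'm2" +
  assumes triangle_left:
      "eq_transf C (comp_transf S (transf_functor \<epsilon> K) (functor_transf K \<eta>)) (id_transf S K)"
    and triangle_right:
      "eq_transf S (comp_transf C (functor_transf J \<epsilon>) (transf_functor \<eta> J)) (id_transf C J)"

definition full_subcat :: "('o, 'm) cat \<Rightarrow> 'o set \<Rightarrow> ('o, 'm) cat" where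
  "full_subcat C A = C\<lparr>Obj := A, Arr := {f \<in> Arr C. Dom C f \<in> A \<and> Cod C f \<in> A}\<rparr>"

text \<open>
  A localization is given by the object set of a full subcategory (not assumed to be closed
  under isomorphisms), the reflector onto it and the unit of the adjunction.
\<close>

record ('o, 'm) loc_data =
  loc_objs :: "'o set"
  reflector :: "('o, 'm, 'o, 'm) cat_maps"
  loc_unit :: "'o \<Rightarrow> 'm"

definition loc_functor :: "('o, 'm) loc_data \<Rightarrow> ('o, 'm, 'o, 'm) cat_maps" where
  "loc_functor L = id_maps \<circ>\<^sub>F reflector L"

locale localization = category C for C :: "('o, 'm) cat" +
  fixes L :: "('o, 'm) loc_data"
  assumes loc_objs_sub: "loc_objs L \<subseteq> Obj C"
    and reflective:
      "\<exists>\<epsilon>. adjunction C (full_subcat C (loc_objs L)) (reflector L) id_maps (loc_unit L) \<epsilon>"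

definition is_local :: "('o, 'm) cat \<Rightarrow> ('o, 'm) loc_data \<Rightarrow> 'o \<Rightarrow> bool" where
  "is_local C L X \<longleftrightarrow> X \<in> Obj C \<and> (\<exists>Y \<in> loc_objs L. isomorphic C X Y)"

definition is_equivalence :: "('o, 'm) cat \<Rightarrow> ('o, 'm) loc_data \<Rightarrow> 'm \<Rightarrow> bool" where
  "is_equivalence C L g \<longleftrightarrow> g \<in> Arr C \<and> is_iso C (AMap (loc_functor L) g)"

definition preserves_local ::
  "('o1, 'm1) cat \<Rightarrow> ('o1, 'm1) loc_data \<Rightarrow> ('o2, 'm2) cat \<Rightarrow> ('o2, 'm2) loc_data \<Rightarrow>
   ('o1, 'm1, 'o2, 'm2) cat_maps \<Rightarrow> bool" where
  "preserves_local C1 L1 C2 L2 F \<longleftrightarrow> (\<forall>X. is_local C1 L1 X \<longrightarrow> is_local C2 L2 (OMap F X))"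

definition preserves_equivalences ::
  "('o1, 'm1) cat \<Rightarrow> ('o1, 'm1) loc_data \<Rightarrow> ('o2, 'm2) cat \<Rightarrow> ('o2, 'm2) loc_data \<Rightarrow>
   ('o1, 'm1, 'o2, 'm2) cat_maps \<Rightarrow> bool" where
  "preserves_equivalences C1 L1 C2 L2 F \<longleftrightarrow>
     (\<forall>f. is_equivalence C1 L1 f \<longrightarrow> is_equivalence C2 L2 (AMap F f))"

text \<open>The transformations \<open>\<alpha> : FL\<^sub>1 \<rightarrow> L\<^sub>2F\<close> and \<open>\<beta> : L\<^sub>2F \<rightarrow> FL\<^sub>1\<close> that are compatible with the units.\<close>

definition unit_compat_out ::
  "('o1, 'm1) cat \<Rightarrow> ('o1, 'm1) loc_data \<Rightarrow> ('o2, 'm2) cat \<Rightarrow> ('o2, 'm2) loc_data \<Rightarrow>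
   ('o1, 'm1, 'o2, 'm2) cat_maps \<Rightarrow> ('o1 \<Rightarrow> 'm2) \<Rightarrow> bool" where
  "unit_compat_out C1 L1 C2 L2 F \<alpha> \<longleftrightarrow>
     nat_transf C1 C2 (F \<circ>\<^sub>F loc_functor L1) (loc_functor L2 \<circ>\<^sub>F F) \<alpha> \<and>
     eq_transf C1 (comp_transf C2 \<alpha> (functor_transf F (loc_unit L1)))
       (transf_functor (loc_unit L2) F)"

definition unit_compat_in ::
  "('o1, 'm1) cat \<Rightarrow> ('o1, 'm1) loc_data \<Rightarrow> ('o2, 'm2) cat \<Rightarrow> ('o2, 'm2) loc_data \<Rightarrow>
   ('o1, 'm1, 'o2, 'm2) cat_maps \<Rightarrow> ('o1 \<Rightarrow> 'm2) \<Rightarrow> bool" where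
  "unit_compat_in C1 L1 C2 L2 F \<beta> \<longleftrightarrow>
     nat_transf C1 C2 (loc_functor L2 \<circ>\<^sub>F F) (F \<circ>\<^sub>F loc_functor L1) \<beta> \<and>
     eq_transf C1 (comp_transf C2 \<beta> (transf_functor (loc_unit L2) F))
       (functor_transf F (loc_unit L1))"

end

theory Submission imports Defs begin

text \<open>
  The unit \<open>l\<close> of a localization \<open>L\<close> is universal among arrows into local objects, and a
  morphism is an \<open>L\<close>-equivalence exactly when every arrow into a local object extends
  uniquely along it. Hence an \<open>L\<close>-equivalence between local objects is invertible.

  If \<open>F\<close> preserves equivalences, each \<open>Fl\<^sub>1\<close> is an \<open>L\<^sub>2\<close>-equivalence and \<open>\<alpha>\<close> is the unique extension
  of \<open>l\<^sub>2F\<close> along it. Conversely, \<open>\<alpha>\<close> yields extensions along \<open>Fl\<^sub>1\<close>, and its naturality together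
  with \<open>L\<^sub>1l\<^sub>1 = l\<^sub>1L\<^sub>1\<close> yields their uniqueness; for an \<open>L\<^sub>1\<close>-equivalence \<open>f\<close>, two-out-of-three in
  the naturality square of \<open>l\<^sub>1\<close> at \<open>f\<close> then shows that \<open>Ff\<close> is an \<open>L\<^sub>2\<close>-equivalence.
  Dually, if \<open>F\<close> preserves local objects, \<open>\<beta>\<close> is the unique extension of \<open>Fl\<^sub>1\<close> along \<open>l\<^sub>2F\<close>;
  conversely, \<open>\<beta>\<close> makes \<open>FX\<close> a retract of \<open>L\<^sub>2FX\<close> for local \<open>X\<close>, which forces \<open>FX\<close> to be local.
\<close>

section \<open>Isomorphisms in a category\<close>

context category
begin

lemma hom_obj:
  assumes "f \<in> hom C a b"
  shows "a \<in> Obj C" "b \<in> Obj C"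
  using assms dom_obj cod_obj by (auto simp: hom_def)

lemma iso_betweenE:
  assumes "iso_between C a b f"
  obtains g where "f \<in> hom C a b" "g \<in> hom C b a"
    "Comp C g f = Ident C a" "Comp C f g = Ident C b"
  using assms by (auto simp: iso_between_def)

lemma iso_betweenI:
  assumes "f \<in> hom C a b" "g \<in> hom C b a" "Comp C g f = Ident C a" "Comp C f g = Ident C b"
  shows "iso_between C a b f"
  using assms by (auto simp: iso_between_def)

lemma iso_between_comp:
  assumes f: "iso_between C a b f" and g: "iso_between C b c g"
  shows "iso_between C a c (Comp C g f)"
proof -
  obtain f' where f': "f \<in> hom C a b" "f' \<in> hom C b a"
    "Comp C f' f = Ident C a" "Comp C f f' = Ident C b" using f by (rule iso_betweenE)
  obtain g' where g': "g \<in> hom C b c" "g' \<in> hom C c b"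
    "Comp C g' g = Ident C b" "Comp C g g' = Ident C c" using g by (rule iso_betweenE)
  have "Comp C (Comp C f' g') (Comp C g f) = Comp C f' (Comp C (Comp C g' g) f)"
    using comp_assoc[OF comp_hom[OF f'(1) g'(1)] g'(2) f'(2)] comp_assoc[OF f'(1) g'(1,2)] by simp
  moreover have "Comp C (Comp C g f) (Comp C f' g') = Comp C g (Comp C (Comp C f f') g')"
    using comp_assoc[OF comp_hom[OF g'(2) f'(2)] f'(1) g'(1)] comp_assoc[OF g'(2) f'(2,1)] by simp
  ultimately show ?thesis
    using iso_betweenI[OF comp_hom[OF f'(1) g'(1)] comp_hom[OF g'(2) f'(2)]] f'(3,4) g'(3,4)
      comp_ident_left[OF f'(1)] comp_ident_left[OF g'(2)] by simp
qed

lemma iso_between_inverse: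
  assumes "iso_between C a b f"
  obtains g where "iso_between C b a g" "Comp C g f = Ident C a" "Comp C f g = Ident C b"
  using assms by (auto simp: iso_between_def)

lemma iso_between_cancel_left:
  assumes f: "f \<in> hom C a b" and g: "iso_between C b c g" and gf: "iso_between C a c (Comp C g f)"
  shows "iso_between C a b f"
proof -
  obtain g' where g': "iso_between C c b g'" "Comp C g' g = Ident C b"
    using g by (rule iso_between_inverse)
  then have "Comp C g' (Comp C g f) = f"
    using comp_assoc[OF f, where g = g and h = g' and c = c and d = b] comp_ident_left[OF f] g by (simp add: iso_between_def)
  then show ?thesis using iso_between_comp[OF gf g'(1)] by simp
qed

lemma iso_between_cancel_right:
  assumes f: "iso_between C a b f" and g: "g \<in> hom C b c" and gf: "iso_between C a c (Comp C g f)"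
  shows "iso_between C b c g"
proof -
  obtain f' where f': "iso_between C b a f'" "Comp C f f' = Ident C b"
    using f by (rule iso_between_inverse)
  then have "Comp C (Comp C g f) f' = g"
    using comp_assoc[OF _ _ g, where f = f' and g = f and a = b and b = a] comp_ident_right[OF g] f by (simp add: iso_between_def)
  then show ?thesis using iso_between_comp[OF f'(1) gf] by simp
qed

lemma is_iso_iff:
  assumes "f \<in> hom C a b"
  shows "is_iso C f \<longleftrightarrow> iso_between C a b f"
  using assms by (auto simp: is_iso_def hom_def)

end

section \<open>Functors and natural isomorphisms\<close>

lemma (in cat_functor) iso_between_amap:
  assumes "iso_between C a b f"
  shows "iso_between D (OMap F a) (OMap F b) (AMap F f)"
proof -
  obtain g where g: "f \<in> hom C a b" "g \<in> hom C b a"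
    "Comp C g f = Ident C a" "Comp C f g = Ident C b" using assms by (rule C.iso_betweenE)
  then show ?thesis
    using D.iso_betweenI[OF amap_hom[OF g(1)] amap_hom[OF g(2)]] amap_comp[OF g(1,2)]
      amap_comp[OF g(2,1)] amap_ident C.hom_obj[OF g(1)] by simp
qed

lemma cat_functor_comp:
  assumes "cat_functor C D F" "cat_functor D E G"
  shows "cat_functor C E (G \<circ>\<^sub>F F)"
proof -
  interpret F: cat_functor C D F by fact
  interpret G: cat_functor D E G by fact
  show ?thesis
    by unfold_locales
      (simp_all add: comp_maps_def F.omap_obj G.omap_obj F.amap_ident G.amap_ident
        F.amap_hom G.amap_hom F.amap_comp G.amap_comp[OF F.amap_hom F.amap_hom])
qed

text \<open>Inverses chosen object by object are automatically natural, so invertibility may be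
  tested on components.\<close>

lemma (in nat_transf) nat_iso_iff:
  "nat_iso C D F G \<tau> \<longleftrightarrow> (\<forall>a \<in> Obj C. iso_between D (OMap F a) (OMap G a) (\<tau> a))"
proof
  assume "nat_iso C D F G \<tau>"
  then obtain \<sigma> where \<sigma>: "nat_transf C D G F \<sigma>"
    "eq_transf C (comp_transf D \<sigma> \<tau>) (id_transf D F)"
    "eq_transf C (comp_transf D \<tau> \<sigma>) (id_transf D G)" by (auto simp: nat_iso_def)
  then show "\<forall>a \<in> Obj C. iso_between D (OMap F a) (OMap G a) (\<tau> a)"
    using component_hom nat_transf.component_hom[OF \<sigma>(1)]
    by (auto simp: eq_transf_def comp_transf_def id_transf_def iso_between_def)
next
  assume "\<forall>a \<in> Obj C. iso_between D (OMap F a) (OMap G a) (\<tau> a)"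
  then have "\<forall>a \<in> Obj C. \<exists>g. g \<in> hom D (OMap G a) (OMap F a) \<and>
      Comp D g (\<tau> a) = Ident D (OMap F a) \<and> Comp D (\<tau> a) g = Ident D (OMap G a)"
    by (auto simp: iso_between_def)
  then obtain \<sigma> where \<sigma>: "\<And>a. a \<in> Obj C \<Longrightarrow> \<sigma> a \<in> hom D (OMap G a) (OMap F a)"
    "\<And>a. a \<in> Obj C \<Longrightarrow> Comp D (\<sigma> a) (\<tau> a) = Ident D (OMap F a)"
    "\<And>a. a \<in> Obj C \<Longrightarrow> Comp D (\<tau> a) (\<sigma> a) = Ident D (OMap G a)"
    by metis
  have "nat_transf C D G F \<sigma>"
  proof unfold_locales
    fix f a b assume f: "f \<in> hom C a b"
    then have ab: "a \<in> Obj C" "b \<in> Obj C" by (auto dest: F.C.hom_obj)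
    note h = F.amap_hom[OF f] G.amap_hom[OF f] \<sigma>(1)[OF ab(1)] \<sigma>(1)[OF ab(2)]
      component_hom[OF ab(1)] component_hom[OF ab(2)]
    \<comment> \<open>Inserting the identity \<open>Comp D (\<tau> a) (\<sigma> a)\<close> on the
      right lets the naturality of \<open>\<tau>\<close> act; afterwards \<open>\<sigma> b\<close>
      cancels \<open>\<tau> b\<close>.\<close>
    have "Comp D (\<sigma> b) (AMap G f) = Comp D (\<sigma> b) (Comp D (AMap G f) (Comp D (\<tau> a) (\<sigma> a)))"
      using \<sigma>(3)[OF ab(1)] h by (simp add: F.D.comp_ident_right)
    also have "\<dots> = Comp D (\<sigma> b) (Comp D (Comp D (\<tau> b) (AMap F f)) (\<sigma> a))"
      using naturality[OF f] F.D.comp_assoc[OF h(3,5,2)] by simp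
    also have "\<dots> = Comp D (Comp D (\<sigma> b) (\<tau> b)) (Comp D (AMap F f) (\<sigma> a))"
      using F.D.comp_assoc[OF h(3,1,6)] F.D.comp_assoc[OF F.D.comp_hom[OF h(3,1)] h(6,4)] by simp
    also have "\<dots> = Comp D (AMap F f) (\<sigma> a)"
      using \<sigma>(2)[OF ab(2)] F.D.comp_ident_left[OF F.D.comp_hom[OF h(3) h(1)]] by simp
    finally show "Comp D (\<sigma> b) (AMap G f) = Comp D (AMap F f) (\<sigma> a)" .
  qed (fact \<sigma>(1))
  then show "nat_iso C D F G \<tau>"
    using \<sigma> nat_transf_axioms
    by (auto simp: nat_iso_def eq_transf_def comp_transf_def id_transf_def)
qed

section \<open>The reflection and the universal property of its unit\<close>

context localization
begin

lemma hom_full_subcat: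
  "hom (full_subcat C A) a b = (if a \<in> A \<and> b \<in> A then hom C a b else {})"
  by (auto simp: hom_def full_subcat_def)

lemma reflection:
  obtains \<epsilon> where "adjunction C (full_subcat C (loc_objs L)) (reflector L) id_maps (loc_unit L) \<epsilon>"
  using reflective by blast

lemma loc_functor_omap_in:
  assumes "a \<in> Obj C"
  shows "OMap (loc_functor L) a \<in> loc_objs L"
proof -
  obtain \<epsilon> where "adjunction C (full_subcat C (loc_objs L)) (reflector L) id_maps (loc_unit L) \<epsilon>"
    by (rule reflection)
  then interpret adjunction C "full_subcat C (loc_objs L)" "reflector L" id_maps "loc_unit L" \<epsilon> .
  show ?thesis
    using K.omap_obj[OF assms] by (simp add: full_subcat_def loc_functor_def comp_maps_def id_maps_def)
qed

lemma loc_functor: "cat_functor C C (loc_functor L)"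
  and nat_transf_loc_unit: "nat_transf C C id_maps (loc_functor L) (loc_unit L)"
proof -
  obtain \<epsilon> where "adjunction C (full_subcat C (loc_objs L)) (reflector L) id_maps (loc_unit L) \<epsilon>"
    by (rule reflection)
  then interpret adjunction C "full_subcat C (loc_objs L)" "reflector L" id_maps "loc_unit L" \<epsilon> .
  show "cat_functor C C (loc_functor L)"
    unfolding loc_functor_def by (rule unit.G.cat_functor_axioms)
  show "nat_transf C C id_maps (loc_functor L) (loc_unit L)"
    unfolding loc_functor_def by (rule unit.nat_transf_axioms)
qed

sublocale L: cat_functor C C "loc_functor L" by (rule loc_functor)

lemma loc_unit_hom: "a \<in> Obj C \<Longrightarrow> loc_unit L a \<in> hom C a (OMap (loc_functor L) a)"
  using nat_transf.component_hom[OF nat_transf_loc_unit] by (simp add: id_maps_def)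

lemma loc_unit_natural:
  "f \<in> hom C a b \<Longrightarrow> Comp C (loc_unit L b) f = Comp C (AMap (loc_functor L) f) (loc_unit L a)"
  using nat_transf.naturality[OF nat_transf_loc_unit] by (simp add: id_maps_def)

lemma is_local_loc_functor: "a \<in> Obj C \<Longrightarrow> is_local C L (OMap (loc_functor L) a)"
  using loc_functor_omap_in[of a] L.omap_obj[of a] ident_hom comp_ident_left
  by (fastforce simp: is_local_def isomorphic_def iso_between_def)

text \<open>The extension is the adjoint transpose of \<open>f\<close>, namely the reflected arrow
  followed by the counit at \<open>y\<close>. Each triangle identity accounts for one half: the
  right one for existence, the left one for uniqueness.\<close>

lemma unit_extend_subcat:
  assumes a: "a \<in> Obj C" and y: "y \<in> loc_objs L" and f: "f \<in> hom C a y"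
  shows "\<exists>!g. g \<in> hom C (OMap (loc_functor L) a) y \<and> Comp C g (loc_unit L a) = f"
proof -
  obtain \<epsilon> where "adjunction C (full_subcat C (loc_objs L)) (reflector L) id_maps (loc_unit L) \<epsilon>"
    by (rule reflection)
  then interpret adjunction C "full_subcat C (loc_objs L)" "reflector L" id_maps "loc_unit L" \<epsilon> .
  let ?l = "loc_unit L" and ?LO = "OMap (loc_functor L)" and ?LA = "AMap (loc_functor L)"
  \<comment> \<open>The inclusion acts as the identity on objects and arrows, so the adjunction data
    on the subcategory can be restated as equations in \<open>C\<close>.\<close>
  have red: "OMap (reflector L) = ?LO" "AMap (reflector L) = ?LA"
    by (auto simp: loc_functor_def comp_maps_def id_maps_def)
  have Obj_S: "Obj (full_subcat C (loc_objs L)) = loc_objs L"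
    and Comp_S: "Comp (full_subcat C (loc_objs L)) = Comp C"
    and Ident_S: "Ident (full_subcat C (loc_objs L)) = Ident C"
    by (auto simp: full_subcat_def)
  have yC: "y \<in> Obj C" using y loc_objs_sub by auto
  have eps: "\<epsilon> z \<in> hom C (?LO z) z" if "z \<in> loc_objs L" for z
    using counit.component_hom[of z] that
    by (auto simp: Obj_S hom_full_subcat comp_maps_def id_maps_def red split: if_splits)
  have eps_nat: "Comp C (\<epsilon> w) (?LA g) = Comp C g (\<epsilon> z)"
    if "g \<in> hom C z w" "z \<in> loc_objs L" "w \<in> loc_objs L" for g z w
    using counit.naturality[of g z w] that
    by (simp add: hom_full_subcat Comp_S comp_maps_def id_maps_def red)
  have tri_left: "Comp C (\<epsilon> (?LO z)) (?LA (?l z)) = Ident C (?LO z)" if "z \<in> Obj C" for z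
    using triangle_left that
    by (simp add: eq_transf_def comp_transf_def id_transf_def transf_functor_def
        functor_transf_def Comp_S Ident_S red)
  have tri_right: "Comp C (\<epsilon> z) (?l z) = Ident C z" if "z \<in> loc_objs L" for z
    using triangle_right that
    by (simp add: eq_transf_def comp_transf_def id_transf_def transf_functor_def
        functor_transf_def Obj_S id_maps_def)
  show ?thesis
  proof (rule ex1I)
    have "Comp C (Comp C (\<epsilon> y) (?LA f)) (?l a) = Comp C (\<epsilon> y) (Comp C (?l y) f)"
      using comp_assoc[OF loc_unit_hom[OF a] L.amap_hom[OF f] eps[OF y]] loc_unit_natural[OF f]
      by simp
    also have "\<dots> = f"
      using comp_assoc[OF f loc_unit_hom[OF yC] eps[OF y]] tri_right[OF y] comp_ident_left[OF f]
      by simp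
    finally show "Comp C (\<epsilon> y) (?LA f) \<in> hom C (?LO a) y \<and> Comp C (Comp C (\<epsilon> y) (?LA f)) (?l a) = f"
      using comp_hom[OF L.amap_hom[OF f] eps[OF y]] by simp
  next
    fix g assume g: "g \<in> hom C (?LO a) y \<and> Comp C g (?l a) = f"
    then have gh: "g \<in> hom C (?LO a) y" and gf: "Comp C g (?l a) = f" by auto
    note La = loc_functor_omap_in[OF a]
    \<comment> \<open>The left triangle identity at \<open>a\<close> supplies an identity that
      brings in the counit; its naturality at \<open>g\<close> then rewrites \<open>g\<close> in
      terms of \<open>f\<close> alone.\<close>
    have "g = Comp C g (Comp C (\<epsilon> (?LO a)) (?LA (?l a)))"
      using tri_left[OF a] comp_ident_right[OF gh] by simp
    also have "\<dots> = Comp C (Comp C g (\<epsilon> (?LO a))) (?LA (?l a))"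
      using comp_assoc[OF L.amap_hom[OF loc_unit_hom[OF a]] eps[OF La] gh] by simp
    also have "\<dots> = Comp C (\<epsilon> y) (Comp C (?LA g) (?LA (?l a)))"
      using eps_nat[OF gh La y]
        comp_assoc[OF L.amap_hom[OF loc_unit_hom[OF a]] L.amap_hom[OF gh] eps[OF y]] by simp
    also have "\<dots> = Comp C (\<epsilon> y) (?LA f)"
      using L.amap_comp[OF loc_unit_hom[OF a] gh] gf by simp
    finally show "g = Comp C (\<epsilon> y) (?LA f)" .
  qed
qed

lemma is_local_obj: "is_local C L y \<Longrightarrow> y \<in> Obj C"
  by (simp add: is_local_def)

text \<open>An isomorphism \<open>i\<close> from \<open>y\<close> to an object \<open>z\<close> of
  the subcategory carries the problem to \<open>z\<close>, and its inverse \<open>j\<close> carries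
  the solution back.\<close>

lemma unit_extend:
  assumes "is_local C L y" and f: "f \<in> hom C a y"
  obtains g where "g \<in> hom C (OMap (loc_functor L) a) y" "Comp C g (loc_unit L a) = f"
proof -
  note a = hom_obj(1)[OF f]
  obtain z i where z: "z \<in> loc_objs L" and "iso_between C y z i"
    using assms(1) by (auto simp: is_local_def isomorphic_def)
  then obtain j where i: "i \<in> hom C y z" and j: "j \<in> hom C z y" "Comp C j i = Ident C y"
    by (blast elim: iso_betweenE)
  obtain g where g: "g \<in> hom C (OMap (loc_functor L) a) z"
    "Comp C g (loc_unit L a) = Comp C i f"
    using unit_extend_subcat[OF a z comp_hom[OF f i]] by blast
  have "Comp C (Comp C j g) (loc_unit L a) = Comp C j (Comp C i f)"
    using comp_assoc[OF loc_unit_hom[OF a] g(1) j(1)] g(2) by simp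
  also have "\<dots> = f"
    using comp_assoc[OF f i j(1)] j(2) comp_ident_left[OF f] by simp
  finally show thesis using that comp_hom[OF g(1) j(1)] by blast
qed

lemma unit_cancel:
  assumes "is_local C L y"
    and g: "g \<in> hom C (OMap (loc_functor L) a) y" and h: "h \<in> hom C (OMap (loc_functor L) a) y"
    and a: "a \<in> Obj C" and gh: "Comp C g (loc_unit L a) = Comp C h (loc_unit L a)"
  shows "g = h"
proof -
  obtain z i where z: "z \<in> loc_objs L" and "iso_between C y z i"
    using assms(1) by (auto simp: is_local_def isomorphic_def)
  then obtain j where i: "i \<in> hom C y z" and j: "j \<in> hom C z y" "Comp C j i = Ident C y"
    by (blast elim: iso_betweenE)
  note l = loc_unit_hom[OF a]
  have "Comp C (Comp C i g) (loc_unit L a) = Comp C (Comp C i h) (loc_unit L a)"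
    using comp_assoc[OF l g i] comp_assoc[OF l h i] gh by simp
  \<comment> \<open>Both are extensions of one and the same arrow into \<open>z\<close>, where
    extensions are unique; \<open>j\<close> then removes \<open>i\<close>.\<close>
  then have "Comp C i g = Comp C i h"
    using unit_extend_subcat[OF a z, of "Comp C (Comp C i g) (loc_unit L a)"]
      comp_hom[OF g i] comp_hom[OF h i] comp_hom[OF l] by metis
  then show ?thesis
    using comp_assoc[OF g i j(1)] comp_assoc[OF h i j(1)] j(2)
      comp_ident_left[OF g] comp_ident_left[OF h] by simp
qed

section \<open>Equivalences, extension along them, and recognition of local objects\<close>

lemma is_equivalence_iff:
  assumes "f \<in> hom C a b"
  shows "is_equivalence C L f \<longleftrightarrow>
    iso_between C (OMap (loc_functor L) a) (OMap (loc_functor L) b) (AMap (loc_functor L) f)"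
  using assms is_iso_iff[OF L.amap_hom[OF assms]] by (auto simp: is_equivalence_def hom_def)

text \<open>Extend \<open>h\<close> along the unit at \<open>a\<close>, precompose with the inverse
  of the localized \<open>f\<close>, and restrict along the unit at \<open>b\<close>. Naturality of
  the unit at \<open>f\<close> shows that the result extends \<open>h\<close>.\<close>

lemma equivalence_extend:
  assumes e: "is_equivalence C L f" and f: "f \<in> hom C a b"
    and y: "is_local C L y" and h: "h \<in> hom C a y"
  obtains g where "g \<in> hom C b y" "Comp C g f = h"
proof -
  note ab = hom_obj[OF f] and Lf = L.amap_hom[OF f]
  obtain h' where h': "h' \<in> hom C (OMap (loc_functor L) a) y" "Comp C h' (loc_unit L a) = h"
    using unit_extend[OF y h] .
  obtain k where k: "k \<in> hom C (OMap (loc_functor L) b) (OMap (loc_functor L) a)"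
    "Comp C k (AMap (loc_functor L) f) = Ident C (OMap (loc_functor L) a)"
    using e is_equivalence_iff[OF f] by (blast elim: iso_betweenE)
  note la = loc_unit_hom[OF ab(1)] and lb = loc_unit_hom[OF ab(2)]
  have "Comp C (Comp C (Comp C h' k) (loc_unit L b)) f
      = Comp C (Comp C h' k) (Comp C (AMap (loc_functor L) f) (loc_unit L a))"
    using comp_assoc[OF f lb comp_hom[OF k(1) h'(1)]] loc_unit_natural[OF f] by simp
  also have "\<dots> = Comp C (Comp C h' (Comp C k (AMap (loc_functor L) f))) (loc_unit L a)"
    using comp_assoc[OF la Lf comp_hom[OF k(1) h'(1)]] comp_assoc[OF Lf k(1) h'(1)] by simp
  also have "\<dots> = h"
    using k(2) h'(2) comp_ident_right[OF h'(1)] by simp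
  finally show thesis
    using that comp_hom[OF lb comp_hom[OF k(1) h'(1)]] by blast
qed

text \<open>The arrows \<open>g\<close> and \<open>h\<close> correspond to \<open>g'\<close> and
  \<open>h'\<close> out of the localization of \<open>b\<close>. These agree after precomposition
  with the localized \<open>f\<close>, which has a right inverse.\<close>

lemma equivalence_cancel:
  assumes e: "is_equivalence C L f" and f: "f \<in> hom C a b"
    and y: "is_local C L y" and g: "g \<in> hom C b y" and h: "h \<in> hom C b y"
    and gh: "Comp C g f = Comp C h f"
  shows "g = h"
proof -
  note ab = hom_obj[OF f] and Lf = L.amap_hom[OF f]
  note la = loc_unit_hom[OF ab(1)] and lb = loc_unit_hom[OF ab(2)]
  obtain k where k: "k \<in> hom C (OMap (loc_functor L) b) (OMap (loc_functor L) a)"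
    "Comp C (AMap (loc_functor L) f) k = Ident C (OMap (loc_functor L) b)"
    using e is_equivalence_iff[OF f] by (blast elim: iso_betweenE)
  obtain g' where g': "g' \<in> hom C (OMap (loc_functor L) b) y" "Comp C g' (loc_unit L b) = g"
    using unit_extend[OF y g] .
  obtain h' where h': "h' \<in> hom C (OMap (loc_functor L) b) y" "Comp C h' (loc_unit L b) = h"
    using unit_extend[OF y h] .
  \<comment> \<open>Naturality of the unit at \<open>f\<close> turns an equation over the unit at
    \<open>a\<close> into one over \<open>f\<close>, where the assumption on \<open>g\<close> and
    \<open>h\<close> applies.\<close>
  have *: "Comp C (Comp C u (AMap (loc_functor L) f)) (loc_unit L a)
      = Comp C (Comp C u (loc_unit L b)) f" if "u \<in> hom C (OMap (loc_functor L) b) y" for u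
    using comp_assoc[OF la Lf that] comp_assoc[OF f lb that] loc_unit_natural[OF f] by simp
  have "Comp C g' (AMap (loc_functor L) f) = Comp C h' (AMap (loc_functor L) f)"
    by (rule unit_cancel[OF y comp_hom[OF Lf g'(1)] comp_hom[OF Lf h'(1)] ab(1)])
      (simp add: *[OF g'(1)] *[OF h'(1)] g'(2) h'(2) gh)
  moreover have "Comp C (Comp C u (AMap (loc_functor L) f)) k = u"
    if "u \<in> hom C (OMap (loc_functor L) b) y" for u
    using comp_assoc[OF k(1) Lf that] k(2) comp_ident_right[OF that] by simp
  ultimately have "g' = h'"
    using g'(1) h'(1) by metis
  then show ?thesis using g'(2) h'(2) by simp
qed

text \<open>Converse of the two preceding results. The inverse of the localized \<open>f\<close> is
  found by extending the unit at \<open>a\<close> first along \<open>f\<close> and then along the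
  unit at \<open>b\<close>; the hypotheses are applied with the localizations of \<open>a\<close>
  and \<open>b\<close> as targets.\<close>

lemma equivalenceI:
  assumes f: "f \<in> hom C a b"
    and ext: "\<And>y h. is_local C L y \<Longrightarrow> h \<in> hom C a y \<Longrightarrow> \<exists>g \<in> hom C b y. Comp C g f = h"
    and cancel: "\<And>y g h. is_local C L y \<Longrightarrow> g \<in> hom C b y \<Longrightarrow> h \<in> hom C b y \<Longrightarrow>
      Comp C g f = Comp C h f \<Longrightarrow> g = h"
  shows "is_equivalence C L f"
proof -
  note ab = hom_obj[OF f] and Lf = L.amap_hom[OF f]
  note la = loc_unit_hom[OF ab(1)] and lb = loc_unit_hom[OF ab(2)]
  note La = is_local_loc_functor[OF ab(1)] and Lb = is_local_loc_functor[OF ab(2)]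
  note idA = ident_hom[OF is_local_obj[OF La]] and idB = ident_hom[OF is_local_obj[OF Lb]]
  obtain g where g: "g \<in> hom C b (OMap (loc_functor L) a)" "Comp C g f = loc_unit L a"
    using ext[OF La la] by blast
  obtain k where k: "k \<in> hom C (OMap (loc_functor L) b) (OMap (loc_functor L) a)"
    "Comp C k (loc_unit L b) = g"
    using unit_extend[OF La g(1)] .
  have "Comp C (Comp C k (AMap (loc_functor L) f)) (loc_unit L a) = loc_unit L a"
    using comp_assoc[OF la Lf k(1)] comp_assoc[OF f lb k(1)] loc_unit_natural[OF f] k(2) g(2)
    by simp
  then have 1: "Comp C k (AMap (loc_functor L) f) = Ident C (OMap (loc_functor L) a)"
    using unit_cancel[OF La comp_hom[OF Lf k(1)] idA ab(1)] comp_ident_left[OF la] by simp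
  have "Comp C (Comp C (AMap (loc_functor L) f) g) f = Comp C (loc_unit L b) f"
    using comp_assoc[OF f g(1) Lf] g(2) loc_unit_natural[OF f] by simp
  \<comment> \<open>Cancelling \<open>f\<close> here is what makes \<open>k\<close> a right inverse
    as well.\<close>
  then have "Comp C (AMap (loc_functor L) f) g = loc_unit L b"
    using cancel[OF Lb comp_hom[OF g(1) Lf] lb] by simp
  then have "Comp C (Comp C (AMap (loc_functor L) f) k) (loc_unit L b) = loc_unit L b"
    using comp_assoc[OF lb k(1) Lf] k(2) by simp
  then have 2: "Comp C (AMap (loc_functor L) f) k = Ident C (OMap (loc_functor L) b)"
    using unit_cancel[OF Lb comp_hom[OF k(1) Lf] idB ab(2)] comp_ident_left[OF lb] by simp
  show ?thesis
    using is_equivalence_iff[OF f] iso_betweenI[OF Lf k(1) 1 2] by simp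
qed

lemma equivalence_unit:
  assumes a: "a \<in> Obj C"
  shows "is_equivalence C L (loc_unit L a)"
proof (rule equivalenceI[OF loc_unit_hom[OF a]])
  show "\<exists>g\<in>hom C (OMap (loc_functor L) a) y. Comp C g (loc_unit L a) = h"
    if "is_local C L y" "h \<in> hom C a y" for y h
    using unit_extend[OF that] by blast
qed (rule unit_cancel[OF _ _ _ a])

text \<open>This and the next two results form the two-out-of-three property, inherited from
  isomorphisms by functoriality of \<open>loc_functor L\<close>.\<close>

lemma equivalence_comp:
  assumes f: "f \<in> hom C a b" and g: "g \<in> hom C b c"
    and "is_equivalence C L f" "is_equivalence C L g"
  shows "is_equivalence C L (Comp C g f)"
  using assms(3,4) L.amap_comp[OF f g] iso_between_comp
  unfolding is_equivalence_iff[OF f] is_equivalence_iff[OF g] is_equivalence_iff[OF comp_hom[OF f g]]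
  by simp

lemma equivalence_cancel_left:
  assumes f: "f \<in> hom C a b" and g: "g \<in> hom C b c"
    and "is_equivalence C L g" "is_equivalence C L (Comp C g f)"
  shows "is_equivalence C L f"
  using assms(3,4) L.amap_comp[OF f g] iso_between_cancel_left[OF L.amap_hom[OF f]]
  unfolding is_equivalence_iff[OF f] is_equivalence_iff[OF g] is_equivalence_iff[OF comp_hom[OF f g]]
  by simp

lemma equivalence_cancel_right:
  assumes f: "f \<in> hom C a b" and g: "g \<in> hom C b c"
    and "is_equivalence C L f" "is_equivalence C L (Comp C g f)"
  shows "is_equivalence C L g"
  using assms(3,4) L.amap_comp[OF f g] iso_between_cancel_right[OF _ L.amap_hom[OF g]]
  unfolding is_equivalence_iff[OF f] is_equivalence_iff[OF g] is_equivalence_iff[OF comp_hom[OF f g]]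
  by simp

lemma equivalence_iso:
  assumes "iso_between C a b f"
  shows "is_equivalence C L f"
proof -
  have "f \<in> hom C a b" using assms by (simp add: iso_between_def)
  then show ?thesis using L.iso_between_amap[OF assms] is_equivalence_iff by simp
qed

text \<open>Since \<open>a\<close> is local, its identity extends along \<open>f\<close> to a left
  inverse. Since \<open>b\<close> is local, uniqueness of extensions makes it a right inverse
  too.\<close>

lemma equivalence_local_iso:
  assumes e: "is_equivalence C L f" and f: "f \<in> hom C a b"
    and a: "is_local C L a" and b: "is_local C L b"
  shows "iso_between C a b f"
proof -
  note ida = ident_hom[OF is_local_obj[OF a]] and idb = ident_hom[OF is_local_obj[OF b]]
  obtain g where g: "g \<in> hom C b a" "Comp C g f = Ident C a"
    using equivalence_extend[OF e f a ida] .
  have "Comp C (Comp C f g) f = Comp C (Ident C b) f"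
    using comp_assoc[OF f g(1) f] g(2) comp_ident_left[OF f] comp_ident_right[OF f] by simp
  then have "Comp C f g = Ident C b"
    using equivalence_cancel[OF e f b comp_hom[OF g(1) f] idb] by simp
  then show ?thesis using iso_betweenI[OF f g] by simp
qed

text \<open>The unit is an equivalence with local target, hence invertible once its source is local.
  Conversely, its target lies in the subcategory itself.\<close>

lemma local_iff_unit_iso:
  assumes a: "a \<in> Obj C"
  shows "is_local C L a \<longleftrightarrow> iso_between C a (OMap (loc_functor L) a) (loc_unit L a)"
proof
  assume "is_local C L a"
  from equivalence_local_iso[OF equivalence_unit[OF a] loc_unit_hom[OF a] this
      is_local_loc_functor[OF a]]
  show "iso_between C a (OMap (loc_functor L) a) (loc_unit L a)" .
next
  assume "iso_between C a (OMap (loc_functor L) a) (loc_unit L a)"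
  then show "is_local C L a"
    using a loc_functor_omap_in[OF a] L.omap_obj[OF a]
    unfolding is_local_def isomorphic_def by blast
qed

lemma local_iso:
  assumes i: "iso_between C a b i" and b: "is_local C L b"
  shows "is_local C L a"
proof -
  have "i \<in> hom C a b" using i by (simp add: iso_between_def)
  then have "a \<in> Obj C" by (rule hom_obj)
  moreover obtain z j where z: "z \<in> loc_objs L" "iso_between C b z j"
    using b unfolding is_local_def isomorphic_def by blast
  moreover have "iso_between C a z (Comp C j i)" by (rule iso_between_comp[OF i z(2)])
  ultimately show ?thesis using loc_objs_sub
    unfolding is_local_def isomorphic_def by blast
qed

text \<open>A left inverse of the unit is two-sided: \<open>Comp C (loc_unit L a) g\<close> and the
  identity restrict to the same arrow along the unit.\<close>

lemma local_if_unit_retraction: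
  assumes a: "a \<in> Obj C" and g: "g \<in> hom C (OMap (loc_functor L) a) a"
    and gl: "Comp C g (loc_unit L a) = Ident C a"
  shows "is_local C L a"
proof -
  note l = loc_unit_hom[OF a] and La = is_local_loc_functor[OF a]
  have "Comp C (Comp C (loc_unit L a) g) (loc_unit L a) = loc_unit L a"
    using comp_assoc[OF l g l] gl comp_ident_right[OF l] by simp
  then have "Comp C (loc_unit L a) g = Ident C (OMap (loc_functor L) a)"
    using unit_cancel[OF La comp_hom[OF g l] ident_hom[OF is_local_obj[OF La]] a]
      comp_ident_left[OF l] by simp
  then show ?thesis
    using local_iff_unit_iso[OF a] iso_betweenI[OF l g gl] by simp
qed

text \<open>Naturality of the unit at the unit itself says that both sides agree after restriction
  along \<open>loc_unit L a\<close>, and their target is local. This is the idempotence of the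
  monad.\<close>

lemma loc_functor_unit:
  assumes a: "a \<in> Obj C"
  shows "AMap (loc_functor L) (loc_unit L a) = loc_unit L (OMap (loc_functor L) a)"
proof -
  note l = loc_unit_hom[OF a] and La = L.omap_obj[OF a]
  show ?thesis
    by (rule unit_cancel[OF is_local_loc_functor[OF La] L.amap_hom[OF l] loc_unit_hom[OF La] a
          loc_unit_natural[OF l, symmetric]])
qed

end

section \<open>A functor between two categories with localizations\<close>

locale functor_between_localizations =
  F: cat_functor C1 C2 F + A: localization C1 L1 + B: localization C2 L2
  for C1 :: "('o1, 'm1) cat" and C2 :: "('o2, 'm2) cat"
    and F :: "('o1, 'm1, 'o2, 'm2) cat_maps"
    and L1 :: "('o1, 'm1) loc_data" and L2 :: "('o2, 'm2) loc_data"
begin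

lemma functor_out: "cat_functor C1 C2 (F \<circ>\<^sub>F loc_functor L1)"
  by (rule cat_functor_comp[OF A.loc_functor F.cat_functor_axioms])

lemma functor_in: "cat_functor C1 C2 (loc_functor L2 \<circ>\<^sub>F F)"
  by (rule cat_functor_comp[OF F.cat_functor_axioms B.loc_functor])

lemma amap_unit_hom:
  "X \<in> Obj C1 \<Longrightarrow> AMap F (loc_unit L1 X) \<in> hom C2 (OMap F X) (OMap F (OMap (loc_functor L1) X))"
  by (rule F.amap_hom[OF A.loc_unit_hom])

lemma unit_at_hom:
  "X \<in> Obj C1 \<Longrightarrow> loc_unit L2 (OMap F X) \<in> hom C2 (OMap F X) (OMap (loc_functor L2) (OMap F X))"
  by (rule B.loc_unit_hom[OF F.omap_obj])

text \<open>Both composite functors are functors automatically, so only the conditions on components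
  and on naturality squares remain.\<close>

lemma unit_compat_out_iff:
  "unit_compat_out C1 L1 C2 L2 F \<alpha> \<longleftrightarrow>
    (\<forall>X \<in> Obj C1. \<alpha> X \<in> hom C2 (OMap F (OMap (loc_functor L1) X)) (OMap (loc_functor L2) (OMap F X)) \<and>
       Comp C2 (\<alpha> X) (AMap F (loc_unit L1 X)) = loc_unit L2 (OMap F X)) \<and>
    (\<forall>X Y. \<forall>f \<in> hom C1 X Y. Comp C2 (\<alpha> Y) (AMap F (AMap (loc_functor L1) f)) =
       Comp C2 (AMap (loc_functor L2) (AMap F f)) (\<alpha> X))"
  using functor_out functor_in
  by (auto simp: unit_compat_out_def nat_transf_def nat_transf_axioms_def eq_transf_def
      comp_transf_def functor_transf_def transf_functor_def comp_maps_def)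

lemma unit_compat_outD:
  assumes "unit_compat_out C1 L1 C2 L2 F \<alpha>"
  shows "X \<in> Obj C1 \<Longrightarrow>
      \<alpha> X \<in> hom C2 (OMap F (OMap (loc_functor L1) X)) (OMap (loc_functor L2) (OMap F X))"
    and "X \<in> Obj C1 \<Longrightarrow> Comp C2 (\<alpha> X) (AMap F (loc_unit L1 X)) = loc_unit L2 (OMap F X)"
    and "f \<in> hom C1 X Y \<Longrightarrow> Comp C2 (\<alpha> Y) (AMap F (AMap (loc_functor L1) f)) =
       Comp C2 (AMap (loc_functor L2) (AMap F f)) (\<alpha> X)"
  using assms unit_compat_out_iff by blast+

lemma unit_compat_in_iff:
  "unit_compat_in C1 L1 C2 L2 F \<beta> \<longleftrightarrow>
    (\<forall>X \<in> Obj C1. \<beta> X \<in> hom C2 (OMap (loc_functor L2) (OMap F X)) (OMap F (OMap (loc_functor L1) X)) \<and>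
       Comp C2 (\<beta> X) (loc_unit L2 (OMap F X)) = AMap F (loc_unit L1 X)) \<and>
    (\<forall>X Y. \<forall>f \<in> hom C1 X Y. Comp C2 (\<beta> Y) (AMap (loc_functor L2) (AMap F f)) =
       Comp C2 (AMap F (AMap (loc_functor L1) f)) (\<beta> X))"
  using functor_out functor_in
  by (auto simp: unit_compat_in_def nat_transf_def nat_transf_axioms_def eq_transf_def
      comp_transf_def functor_transf_def transf_functor_def comp_maps_def)

lemma unit_compat_inD:
  assumes "unit_compat_in C1 L1 C2 L2 F \<beta>"
  shows "X \<in> Obj C1 \<Longrightarrow>
      \<beta> X \<in> hom C2 (OMap (loc_functor L2) (OMap F X)) (OMap F (OMap (loc_functor L1) X))"
    and "X \<in> Obj C1 \<Longrightarrow> Comp C2 (\<beta> X) (loc_unit L2 (OMap F X)) = AMap F (loc_unit L1 X)"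
  using assms unit_compat_in_iff by blast+

lemma amap_unit_natural:
  assumes f: "f \<in> hom C1 X Y"
  shows "Comp C2 (AMap F (loc_unit L1 Y)) (AMap F f) =
    Comp C2 (AMap F (AMap (loc_functor L1) f)) (AMap F (loc_unit L1 X))"
proof -
  have "X \<in> Obj C1" "Y \<in> Obj C1" using F.C.hom_obj[OF f] .
  then show ?thesis
    using F.amap_comp[OF f A.loc_unit_hom] F.amap_comp[OF A.loc_unit_hom A.L.amap_hom[OF f]]
      A.loc_unit_natural[OF f] by simp
qed

section \<open>Preservation of equivalences and the transformation \<open>\<alpha>\<close>\<close>

lemma amap_unit_equivalence_if_preserves_equivalences:
  assumes "preserves_equivalences C1 L1 C2 L2 F" "X \<in> Obj C1"
  shows "is_equivalence C2 L2 (AMap F (loc_unit L1 X))"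
  using assms A.equivalence_unit by (auto simp: preserves_equivalences_def)

text \<open>Reduces preservation of all equivalences to the units, which is the form in which both
  \<open>\<alpha>\<close> and \<open>\<beta>\<close> give access to it.\<close>

lemma preserves_equivalencesI:
  assumes u: "\<And>X. X \<in> Obj C1 \<Longrightarrow> is_equivalence C2 L2 (AMap F (loc_unit L1 X))"
  shows "preserves_equivalences C1 L1 C2 L2 F"
  unfolding preserves_equivalences_def
proof (intro allI impI)
  fix f assume e: "is_equivalence C1 L1 f"
  define X Y where "X = Dom C1 f" and "Y = Cod C1 f"
  have f: "f \<in> hom C1 X Y" using e by (simp add: X_def Y_def hom_def is_equivalence_def)
  note XY = F.C.hom_obj[OF f]
  have "iso_between C1 (OMap (loc_functor L1) X) (OMap (loc_functor L1) Y) (AMap (loc_functor L1) f)"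
    using e A.is_equivalence_iff[OF f] by simp
  \<comment> \<open>This side of the square is even an isomorphism, being the image under
    \<open>F\<close> of one.\<close>
  then have "is_equivalence C2 L2 (AMap F (AMap (loc_functor L1) f))"
    by (rule B.equivalence_iso[OF F.iso_between_amap])
  then have "is_equivalence C2 L2 (Comp C2 (AMap F (loc_unit L1 Y)) (AMap F f))"
    using B.equivalence_comp[OF amap_unit_hom[OF XY(1)] F.amap_hom[OF A.L.amap_hom[OF f]]]
      u[OF XY(1)] amap_unit_natural[OF f] by simp
  then show "is_equivalence C2 L2 (AMap F f)"
    using B.equivalence_cancel_left[OF F.amap_hom[OF f] amap_unit_hom[OF XY(2)] u[OF XY(2)]] by simp
qed

lemma ex_unit_compat_out:
  assumes "preserves_equivalences C1 L1 C2 L2 F"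
  shows "\<exists>\<alpha>. unit_compat_out C1 L1 C2 L2 F \<alpha>"
proof -
  note e = amap_unit_equivalence_if_preserves_equivalences[OF assms]
  have "\<exists>g. g \<in> hom C2 (OMap F (OMap (loc_functor L1) X)) (OMap (loc_functor L2) (OMap F X)) \<and>
      Comp C2 g (AMap F (loc_unit L1 X)) = loc_unit L2 (OMap F X)" if X: "X \<in> Obj C1" for X
    by (rule B.equivalence_extend[OF e[OF X] amap_unit_hom[OF X]
          B.is_local_loc_functor[OF F.omap_obj[OF X]] unit_at_hom[OF X]]) blast
  then obtain \<alpha> where \<alpha>: "\<And>X. X \<in> Obj C1 \<Longrightarrow>
      \<alpha> X \<in> hom C2 (OMap F (OMap (loc_functor L1) X)) (OMap (loc_functor L2) (OMap F X))"
    "\<And>X. X \<in> Obj C1 \<Longrightarrow> Comp C2 (\<alpha> X) (AMap F (loc_unit L1 X)) = loc_unit L2 (OMap F X)"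
    by metis
  have "Comp C2 (\<alpha> Y) (AMap F (AMap (loc_functor L1) f)) =
      Comp C2 (AMap (loc_functor L2) (AMap F f)) (\<alpha> X)" if f: "f \<in> hom C1 X Y" for X Y f
  proof -
    note XY = F.C.hom_obj[OF f]
    note Ff = F.amap_hom[OF f] and uX = amap_unit_hom[OF XY(1)] and uY = amap_unit_hom[OF XY(2)]
    note FLf = F.amap_hom[OF A.L.amap_hom[OF f]] and LFf = B.L.amap_hom[OF F.amap_hom[OF f]]
    note aX = \<alpha>(1)[OF XY(1)] and aY = \<alpha>(1)[OF XY(2)]
    \<comment> \<open>The two legs of the square end in a local object, so it suffices to compare
      them along the equivalence \<open>AMap F (loc_unit L1 X)\<close>, where both reduce to
      naturality of the units.\<close>
    have "Comp C2 (Comp C2 (\<alpha> Y) (AMap F (AMap (loc_functor L1) f))) (AMap F (loc_unit L1 X))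
        = Comp C2 (loc_unit L2 (OMap F Y)) (AMap F f)"
      using F.D.comp_assoc[OF uX FLf aY] F.D.comp_assoc[OF Ff uY aY] amap_unit_natural[OF f]
        \<alpha>(2)[OF XY(2)] by simp
    also have "\<dots> = Comp C2 (Comp C2 (AMap (loc_functor L2) (AMap F f)) (\<alpha> X)) (AMap F (loc_unit L1 X))"
      using F.D.comp_assoc[OF uX aX LFf] B.loc_unit_natural[OF Ff] \<alpha>(2)[OF XY(1)] by simp
    finally show ?thesis
      by (rule B.equivalence_cancel[OF e[OF XY(1)] uX B.is_local_loc_functor[OF F.omap_obj[OF XY(2)]]
            F.D.comp_hom[OF FLf aY] F.D.comp_hom[OF aX LFf]])
  qed
  then show ?thesis using \<alpha> unit_compat_out_iff by blast
qed

text \<open>An extension is obtained by extending along the unit at \<open>OMap F X\<close> and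
  precomposing with \<open>\<alpha> X\<close>. Uniqueness comes from a factorization of the unit at
  \<open>OMap F (OMap (loc_functor L1) X)\<close> through \<open>\<alpha> X\<close>.\<close>

lemma amap_unit_equivalence_if_compat_out:
  assumes "unit_compat_out C1 L1 C2 L2 F \<alpha>" and X: "X \<in> Obj C1"
  shows "is_equivalence C2 L2 (AMap F (loc_unit L1 X))"
proof (rule B.equivalenceI[OF amap_unit_hom[OF X]])
  let ?LX = "OMap (loc_functor L1) X"
  note \<alpha> = unit_compat_outD[OF assms(1)]
  note l = A.loc_unit_hom[OF X] and u = amap_unit_hom[OF X] and LX = A.L.omap_obj[OF X]
  note a = \<alpha>(1)[OF X]
  show "\<exists>g\<in>hom C2 (OMap F ?LX) y. Comp C2 g (AMap F (loc_unit L1 X)) = h"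
    if y: "is_local C2 L2 y" and h: "h \<in> hom C2 (OMap F X) y" for y h
  proof -
    obtain k where k: "k \<in> hom C2 (OMap (loc_functor L2) (OMap F X)) y"
      "Comp C2 k (loc_unit L2 (OMap F X)) = h"
      using B.unit_extend[OF y h] .
    then show ?thesis
      using F.D.comp_assoc[OF u a k(1)] \<alpha>(2)[OF X] F.D.comp_hom[OF a k(1)] by auto
  qed
  show "g = h"
    if y: "is_local C2 L2 y" and g: "g \<in> hom C2 (OMap F ?LX) y" and h: "h \<in> hom C2 (OMap F ?LX) y"
      and gh: "Comp C2 g (AMap F (loc_unit L1 X)) = Comp C2 h (AMap F (loc_unit L1 X))" for y g h
  proof -
    \<comment> \<open>Naturality of \<open>\<alpha>\<close> at \<open>loc_unit L1 X\<close>: by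
      idempotence of \<open>L1\<close>, the leg through \<open>\<alpha> ?LX\<close> is the
      compatibility condition at \<open>?LX\<close>.\<close>
    have *: "loc_unit L2 (OMap F ?LX) = Comp C2 (AMap (loc_functor L2) (AMap F (loc_unit L1 X))) (\<alpha> X)"
      using \<alpha>(3)[OF l] \<alpha>(2)[OF LX] by (simp add: A.loc_functor_unit[OF X])
    obtain g' where g': "g' \<in> hom C2 (OMap (loc_functor L2) (OMap F ?LX)) y"
      "Comp C2 g' (loc_unit L2 (OMap F ?LX)) = g"
      using B.unit_extend[OF y g] .
    obtain h' where h': "h' \<in> hom C2 (OMap (loc_functor L2) (OMap F ?LX)) y"
      "Comp C2 h' (loc_unit L2 (OMap F ?LX)) = h"
      using B.unit_extend[OF y h] .
    note Lu = B.L.amap_hom[OF u]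
    have restrict: "Comp C2 (Comp C2 v (AMap (loc_functor L2) (AMap F (loc_unit L1 X)))) (loc_unit L2 (OMap F X))
        = Comp C2 (Comp C2 v (loc_unit L2 (OMap F ?LX))) (AMap F (loc_unit L1 X))"
      if "v \<in> hom C2 (OMap (loc_functor L2) (OMap F ?LX)) y" for v
      using F.D.comp_assoc[OF unit_at_hom[OF X] Lu that] F.D.comp_assoc[OF u unit_at_hom[OF LX] that]
        B.loc_unit_natural[OF u] by simp
    \<comment> \<open>Restricted along the unit at \<open>OMap F X\<close>, the two sides become the
      two sides of \<open>gh\<close>.\<close>
    have eq: "Comp C2 g' (AMap (loc_functor L2) (AMap F (loc_unit L1 X))) =
        Comp C2 h' (AMap (loc_functor L2) (AMap F (loc_unit L1 X)))"
      by (rule B.unit_cancel[OF y F.D.comp_hom[OF Lu g'(1)] F.D.comp_hom[OF Lu h'(1)] F.omap_obj[OF X]])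
        (simp add: restrict[OF g'(1)] restrict[OF h'(1)] g'(2) h'(2) gh)
    have via: "Comp C2 v (loc_unit L2 (OMap F ?LX)) =
        Comp C2 (Comp C2 v (AMap (loc_functor L2) (AMap F (loc_unit L1 X)))) (\<alpha> X)"
      if "v \<in> hom C2 (OMap (loc_functor L2) (OMap F ?LX)) y" for v
      unfolding * by (rule F.D.comp_assoc[OF a Lu that, symmetric])
    show ?thesis
      by (simp only: g'(2)[symmetric] h'(2)[symmetric] via[OF g'(1)] via[OF h'(1)] eq)
  qed
qed

text \<open>Each component is an extension along an equivalence into a local object.\<close>

lemma unit_compat_out_unique:
  assumes \<alpha>: "unit_compat_out C1 L1 C2 L2 F \<alpha>" and \<alpha>': "unit_compat_out C1 L1 C2 L2 F \<alpha>'"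
  shows "eq_transf C1 \<alpha>' \<alpha>"
  unfolding eq_transf_def
proof
  fix X assume X: "X \<in> Obj C1"
  show "\<alpha>' X = \<alpha> X"
    by (rule B.equivalence_cancel[OF amap_unit_equivalence_if_compat_out[OF \<alpha> X]
          amap_unit_hom[OF X] B.is_local_loc_functor[OF F.omap_obj[OF X]]
          unit_compat_outD(1)[OF \<alpha>' X] unit_compat_outD(1)[OF \<alpha> X]])
      (simp add: unit_compat_outD(2)[OF \<alpha> X] unit_compat_outD(2)[OF \<alpha>' X])
qed

text \<open>Two-out-of-three in the compatibility equation, whose other two arrows are
  equivalences.\<close>

lemma unit_compat_out_equivalence:
  assumes \<alpha>: "unit_compat_out C1 L1 C2 L2 F \<alpha>" and X: "X \<in> Obj C1"
  shows "is_equivalence C2 L2 (\<alpha> X)"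
  using B.equivalence_unit[OF F.omap_obj[OF X]]
    B.equivalence_cancel_right[OF amap_unit_hom[OF X] unit_compat_outD(1)[OF \<alpha> X]
      amap_unit_equivalence_if_compat_out[OF \<alpha> X]]
  by (simp add: unit_compat_outD(2)[OF \<alpha> X])

text \<open>A local object is isomorphic to its localization through the unit, so only localizations
  need testing.\<close>

lemma preserves_local_iff:
  "preserves_local C1 L1 C2 L2 F \<longleftrightarrow>
    (\<forall>X \<in> Obj C1. is_local C2 L2 (OMap F (OMap (loc_functor L1) X)))"
proof
  assume "preserves_local C1 L1 C2 L2 F"
  then show "\<forall>X \<in> Obj C1. is_local C2 L2 (OMap F (OMap (loc_functor L1) X))"
    using A.is_local_loc_functor by (auto simp: preserves_local_def)
next
  assume *: "\<forall>X \<in> Obj C1. is_local C2 L2 (OMap F (OMap (loc_functor L1) X))"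
  show "preserves_local C1 L1 C2 L2 F"
    unfolding preserves_local_def
  proof (intro allI impI)
    fix X assume X: "is_local C1 L1 X"
    note XO = A.is_local_obj[OF X]
    have "iso_between C1 X (OMap (loc_functor L1) X) (loc_unit L1 X)"
      using X A.local_iff_unit_iso[OF XO] by simp
    from B.local_iso[OF F.iso_between_amap[OF this]] show "is_local C2 L2 (OMap F X)"
      using * XO by blast
  qed
qed

lemma unit_compat_out_nat_iso_iff:
  assumes \<alpha>: "unit_compat_out C1 L1 C2 L2 F \<alpha>"
  shows "nat_iso C1 C2 (F \<circ>\<^sub>F loc_functor L1) (loc_functor L2 \<circ>\<^sub>F F) \<alpha> \<longleftrightarrow>
    preserves_local C1 L1 C2 L2 F"
proof -
  have "nat_transf C1 C2 (F \<circ>\<^sub>F loc_functor L1) (loc_functor L2 \<circ>\<^sub>F F) \<alpha>"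
    using \<alpha> by (simp add: unit_compat_out_def)
  then have "nat_iso C1 C2 (F \<circ>\<^sub>F loc_functor L1) (loc_functor L2 \<circ>\<^sub>F F) \<alpha> \<longleftrightarrow>
      (\<forall>X \<in> Obj C1. iso_between C2 (OMap F (OMap (loc_functor L1) X))
        (OMap (loc_functor L2) (OMap F X)) (\<alpha> X))"
    by (simp add: nat_transf.nat_iso_iff comp_maps_def)
  \<comment> \<open>Each \<open>\<alpha> X\<close> is an equivalence with local target, so it is
    invertible exactly when its source is local.\<close>
  also have "\<dots> \<longleftrightarrow> (\<forall>X \<in> Obj C1. is_local C2 L2 (OMap F (OMap (loc_functor L1) X)))"
    using B.equivalence_local_iso[OF unit_compat_out_equivalence[OF \<alpha>] unit_compat_outD(1)[OF \<alpha>]]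
      B.local_iso B.is_local_loc_functor F.omap_obj by blast
  finally show ?thesis using preserves_local_iff by simp
qed

section \<open>Preservation of local objects and the transformation \<open>\<beta>\<close>\<close>

lemma ex_unit_compat_in:
  assumes "preserves_local C1 L1 C2 L2 F"
  shows "\<exists>\<beta>. unit_compat_in C1 L1 C2 L2 F \<beta>"
proof -
  have loc: "is_local C2 L2 (OMap F (OMap (loc_functor L1) X))" if "X \<in> Obj C1" for X
    using assms that preserves_local_iff by blast
  have "\<exists>g. g \<in> hom C2 (OMap (loc_functor L2) (OMap F X)) (OMap F (OMap (loc_functor L1) X)) \<and>
      Comp C2 g (loc_unit L2 (OMap F X)) = AMap F (loc_unit L1 X)" if X: "X \<in> Obj C1" for X
    by (rule B.unit_extend[OF loc[OF X] amap_unit_hom[OF X]]) blast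
  then obtain \<beta> where \<beta>: "\<And>X. X \<in> Obj C1 \<Longrightarrow>
      \<beta> X \<in> hom C2 (OMap (loc_functor L2) (OMap F X)) (OMap F (OMap (loc_functor L1) X))"
    "\<And>X. X \<in> Obj C1 \<Longrightarrow> Comp C2 (\<beta> X) (loc_unit L2 (OMap F X)) = AMap F (loc_unit L1 X)"
    by metis
  have "Comp C2 (\<beta> Y) (AMap (loc_functor L2) (AMap F f)) =
      Comp C2 (AMap F (AMap (loc_functor L1) f)) (\<beta> X)" if f: "f \<in> hom C1 X Y" for X Y f
  proof -
    note XY = F.C.hom_obj[OF f]
    note Ff = F.amap_hom[OF f] and uX = unit_at_hom[OF XY(1)] and uY = unit_at_hom[OF XY(2)]
    note FLf = F.amap_hom[OF A.L.amap_hom[OF f]] and LFf = B.L.amap_hom[OF F.amap_hom[OF f]]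
    note bX = \<beta>(1)[OF XY(1)] and bY = \<beta>(1)[OF XY(2)]
    \<comment> \<open>The common target of the two legs is local by \<open>loc\<close>, so they may
      be compared along the unit at \<open>OMap F X\<close>.\<close>
    have "Comp C2 (Comp C2 (\<beta> Y) (AMap (loc_functor L2) (AMap F f))) (loc_unit L2 (OMap F X))
        = Comp C2 (AMap F (loc_unit L1 Y)) (AMap F f)"
      using F.D.comp_assoc[OF uX LFf bY] F.D.comp_assoc[OF Ff uY bY] B.loc_unit_natural[OF Ff]
        \<beta>(2)[OF XY(2)] by simp
    also have "\<dots> = Comp C2 (Comp C2 (AMap F (AMap (loc_functor L1) f)) (\<beta> X)) (loc_unit L2 (OMap F X))"
      using F.D.comp_assoc[OF uX bX FLf] amap_unit_natural[OF f] \<beta>(2)[OF XY(1)] by simp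
    finally show ?thesis
      by (rule B.unit_cancel[OF loc[OF XY(2)] F.D.comp_hom[OF LFf bY] F.D.comp_hom[OF bX FLf]
            F.omap_obj[OF XY(1)]])
  qed
  then show ?thesis using \<beta> unit_compat_in_iff by blast
qed

lemma preserves_local_if_compat_in:
  assumes "unit_compat_in C1 L1 C2 L2 F \<beta>"
  shows "preserves_local C1 L1 C2 L2 F"
  unfolding preserves_local_def
proof (intro allI impI)
  fix X assume XL: "is_local C1 L1 X"
  note X = A.is_local_obj[OF XL]
  have b: "\<beta> X \<in> hom C2 (OMap (loc_functor L2) (OMap F X)) (OMap F (OMap (loc_functor L1) X))"
    "Comp C2 (\<beta> X) (loc_unit L2 (OMap F X)) = AMap F (loc_unit L1 X)"
    using unit_compat_inD[OF assms X] .
  have "iso_between C1 X (OMap (loc_functor L1) X) (loc_unit L1 X)"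
    using XL A.local_iff_unit_iso[OF X] by simp
  \<comment> \<open>Here \<open>k\<close> inverts the image under \<open>F\<close> of the unit at
    \<open>X\<close>; then \<open>Comp C2 k (\<beta> X)\<close> is a left inverse of the unit at
    \<open>OMap F X\<close>.\<close>
  then obtain k where k: "k \<in> hom C2 (OMap F (OMap (loc_functor L1) X)) (OMap F X)"
    "Comp C2 k (AMap F (loc_unit L1 X)) = Ident C2 (OMap F X)"
    by (blast elim: F.D.iso_betweenE dest: F.iso_between_amap)
  show "is_local C2 L2 (OMap F X)"
    using B.local_if_unit_retraction[OF F.omap_obj[OF X] F.D.comp_hom[OF b(1) k(1)]]
      F.D.comp_assoc[OF unit_at_hom[OF X] b(1) k(1)] b(2) k(2) by simp
qed

lemma unit_compat_in_unique:
  assumes \<beta>: "unit_compat_in C1 L1 C2 L2 F \<beta>" and \<beta>': "unit_compat_in C1 L1 C2 L2 F \<beta>'"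
  shows "eq_transf C1 \<beta>' \<beta>"
  unfolding eq_transf_def
proof
  fix X assume X: "X \<in> Obj C1"
  have "is_local C2 L2 (OMap F (OMap (loc_functor L1) X))"
    using preserves_local_if_compat_in[OF \<beta>] preserves_local_iff X by blast
  then show "\<beta>' X = \<beta> X"
    by (rule B.unit_cancel[OF _ unit_compat_inD(1)[OF \<beta>' X] unit_compat_inD(1)[OF \<beta> X] F.omap_obj[OF X]])
      (simp add: unit_compat_inD(2)[OF \<beta> X] unit_compat_inD(2)[OF \<beta>' X])
qed

lemma unit_compat_in_nat_iso_iff:
  assumes \<beta>: "unit_compat_in C1 L1 C2 L2 F \<beta>"
  shows "nat_iso C1 C2 (loc_functor L2 \<circ>\<^sub>F F) (F \<circ>\<^sub>F loc_functor L1) \<beta> \<longleftrightarrow>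
    preserves_equivalences C1 L1 C2 L2 F"
proof -
  have nt: "nat_transf C1 C2 (loc_functor L2 \<circ>\<^sub>F F) (F \<circ>\<^sub>F loc_functor L1) \<beta>"
    using \<beta> by (simp add: unit_compat_in_def)
  have b: "\<beta> X \<in> hom C2 (OMap (loc_functor L2) (OMap F X)) (OMap F (OMap (loc_functor L1) X))"
    "Comp C2 (\<beta> X) (loc_unit L2 (OMap F X)) = AMap F (loc_unit L1 X)" if "X \<in> Obj C1" for X
    using unit_compat_inD[OF \<beta> that] .
  have loc: "is_local C2 L2 (OMap F (OMap (loc_functor L1) X))" if "X \<in> Obj C1" for X
    using preserves_local_if_compat_in[OF \<beta>] preserves_local_iff that by blast
  have unit_eq: "is_equivalence C2 L2 (loc_unit L2 (OMap F X))" if "X \<in> Obj C1" for X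
    using B.equivalence_unit[OF F.omap_obj[OF that]] .
  have "nat_iso C1 C2 (loc_functor L2 \<circ>\<^sub>F F) (F \<circ>\<^sub>F loc_functor L1) \<beta> \<longleftrightarrow>
      (\<forall>X \<in> Obj C1. iso_between C2 (OMap (loc_functor L2) (OMap F X))
        (OMap F (OMap (loc_functor L1) X)) (\<beta> X))"
    using nat_transf.nat_iso_iff[OF nt] by (simp add: comp_maps_def)
  \<comment> \<open>Source and target of \<open>\<beta> X\<close> are both local, so being
    invertible and being an equivalence coincide.\<close>
  also have "\<dots> \<longleftrightarrow> (\<forall>X \<in> Obj C1. is_equivalence C2 L2 (\<beta> X))"
    using B.equivalence_local_iso[OF _ b(1)] B.equivalence_iso loc B.is_local_loc_functor F.omap_obj
    by blast
  \<comment> \<open>Two-out-of-three in the compatibility equation for \<open>\<beta>\<close>, as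
    the unit of \<open>L2\<close> is an equivalence.\<close>
  also have "\<dots> \<longleftrightarrow> (\<forall>X \<in> Obj C1. is_equivalence C2 L2 (AMap F (loc_unit L1 X)))"
    using B.equivalence_comp[OF unit_at_hom b(1)] B.equivalence_cancel_right[OF unit_at_hom b(1)]
      unit_eq b(2) by (metis (no_types, lifting))
  also have "\<dots> \<longleftrightarrow> preserves_equivalences C1 L1 C2 L2 F"
    using preserves_equivalencesI amap_unit_equivalence_if_preserves_equivalences by blast
  finally show ?thesis .
qed

end

theorem theorem3p2:
  fixes C1 :: "('o1, 'm1) cat" and C2 :: "('o2, 'm2) cat"
    and F :: "('o1, 'm1, 'o2, 'm2) cat_maps"
    and L1 :: "('o1, 'm1) loc_data" and L2 :: "('o2, 'm2) loc_data"
  assumes "cat_functor C1 C2 F"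
    and "localization C1 L1"
    and "localization C2 L2"
  shows
    "(preserves_equivalences C1 L1 C2 L2 F \<longleftrightarrow> (\<exists>\<alpha>. unit_compat_out C1 L1 C2 L2 F \<alpha>)) \<and>
     (\<forall>\<alpha>. unit_compat_out C1 L1 C2 L2 F \<alpha> \<longrightarrow>
        (\<forall>\<alpha>'. unit_compat_out C1 L1 C2 L2 F \<alpha>' \<longrightarrow> eq_transf C1 \<alpha>' \<alpha>) \<and>
        (\<forall>X \<in> Obj C1. is_equivalence C2 L2 (\<alpha> X)) \<and>
        (nat_iso C1 C2 (F \<circ>\<^sub>F loc_functor L1) (loc_functor L2 \<circ>\<^sub>F F) \<alpha> \<longleftrightarrow>
           preserves_local C1 L1 C2 L2 F)) \<and>
     (preserves_local C1 L1 C2 L2 F \<longleftrightarrow> (\<exists>\<beta>. unit_compat_in C1 L1 C2 L2 F \<beta>)) \<and>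
     (\<forall>\<beta>. unit_compat_in C1 L1 C2 L2 F \<beta> \<longrightarrow>
        (\<forall>\<beta>'. unit_compat_in C1 L1 C2 L2 F \<beta>' \<longrightarrow> eq_transf C1 \<beta>' \<beta>) \<and>
        (nat_iso C1 C2 (loc_functor L2 \<circ>\<^sub>F F) (F \<circ>\<^sub>F loc_functor L1) \<beta> \<longleftrightarrow>
           preserves_equivalences C1 L1 C2 L2 F))"
proof -
  interpret functor_between_localizations C1 C2 F L1 L2
    using assms by (simp add: functor_between_localizations_def)
  have "preserves_equivalences C1 L1 C2 L2 F" if "unit_compat_out C1 L1 C2 L2 F \<alpha>" for \<alpha>
    using preserves_equivalencesI amap_unit_equivalence_if_compat_out[OF that] .
  then show ?thesis
    using ex_unit_compat_out unit_compat_out_unique unit_compat_out_equivalence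
      unit_compat_out_nat_iso_iff ex_unit_compat_in preserves_local_if_compat_in
      unit_compat_in_unique unit_compat_in_nat_iso_iff by blast
qed

end
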